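(* There is a subgroup $F$ of $\mathrm{Aut}(\mathbb{Q}\mathbb{U})$ which acts faithfully and homogeneously on $\mathbb{Q}\mathbb{U}$ and is isomorphic to the free group of countably infinite rank.
   Context: $\mathbb{Q}\mathbb{U}$ denotes the rational Urysohn space: the countable metric space with rational distances, unique up to isometry, such that for every finite subset $A$ and every function $g:A\to\mathbb{Q}$ with $g(a)\ge 0$ and $|g(a)-g(b)|\le d(a,b)\le g(a)+g(b)$ for all $a,b\in A$, there is a point $z$ of the space with $d(z,a)=g(a)$ for all $a\in A$. $\mathrm{Aut}(\mathbb{Q}\mathbb{U})$ is the group of all isometries of $\mathbb{Q}\mathbb{U}$ onto itself. A subgroup $F\le \mathrm{Aut}(\mathbb{Q}\mathbb{U})$ acts homogeneously if every isometry between finite subsets of $\mathbb{Q}\mathbb{U}$ is the restriction of some element of $F$. *)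

theory Defs
  imports "HOL-Algebra.Group_Action" "HOL-Analysis.Abstract_Metric_Spaces"
begin

section \<open>The rational Urysohn space\<close>

locale rational_urysohn_space = Metric_space M d
  for M :: "'a set" and d :: "'a \<Rightarrow> 'a \<Rightarrow> real" +
  assumes countable_space: "countable M"
    and rational_dist: "\<lbrakk>x \<in> M; y \<in> M\<rbrakk> \<Longrightarrow> d x y \<in> \<rat>"
    and one_point_extension:
      "\<lbrakk>finite A; A \<subseteq> M;
        \<And>a. a \<in> A \<Longrightarrow> g a \<in> \<rat> \<and> 0 \<le> g a;
        \<And>a b. \<lbrakk>a \<in> A; b \<in> A\<rbrakk> \<Longrightarrow> \<bar>g a - g b\<bar> \<le> d a b \<and> d a b \<le> g a + g b\<rbrakk>
       \<Longrightarrow> \<exists>z\<in>M. \<forall>a\<in>A. d z a = g a"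


section \<open>Isometries\<close>

definition isometry_betw :: "('a \<Rightarrow> 'a \<Rightarrow> real) \<Rightarrow> ('a \<Rightarrow> 'a) \<Rightarrow> 'a set \<Rightarrow> 'a set \<Rightarrow> bool" where
  "isometry_betw d f A B \<longleftrightarrow> bij_betw f A B \<and> (\<forall>x\<in>A. \<forall>y\<in>A. d (f x) (f y) = d x y)"

text \<open>As in \<^const>\<open>BijGroup\<close>, group elements are extensional functions (\<^const>\<open>undefined\<close>
  outside \<open>M\<close>), so that distinct elements differ at some point of \<open>M\<close>.\<close>

definition isometry_group :: "'a set \<Rightarrow> ('a \<Rightarrow> 'a \<Rightarrow> real) \<Rightarrow> ('a \<Rightarrow> 'a) monoid" where
  "isometry_group M d = (BijGroup M)\<lparr>carrier := {f \<in> Bij M. isometry_betw d f M M}\<rparr>"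

lemma subgroup_isometries: "subgroup {f \<in> Bij M. isometry_betw d f M M} (BijGroup M)"
proof (rule group.subgroupI[OF group_BijGroup])
  show "{f \<in> Bij M. isometry_betw d f M M} \<subseteq> carrier (BijGroup M)"
    by (auto simp: BijGroup_def)
  have "(\<lambda>x\<in>M. x) \<in> {f \<in> Bij M. isometry_betw d f M M}"
    using id_Bij[of M] by (auto simp: isometry_betw_def Bij_def)
  then show "{f \<in> Bij M. isometry_betw d f M M} \<noteq> {}" by blast
next
  fix f assume f: "f \<in> {f \<in> Bij M. isometry_betw d f M M}"
  then have bij: "bij_betw f M M" by (simp add: Bij_def)
  have "d (inv_into M f x) (inv_into M f y) = d x y" if "x \<in> M" "y \<in> M" for x y
  proof -
    have "inv_into M f x \<in> M" "inv_into M f y \<in> M"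
      using bij that by (auto simp: bij_betw_def inv_into_into)
    moreover have "f (inv_into M f x) = x" "f (inv_into M f y) = y"
      using bij that by (auto simp: bij_betw_def f_inv_into_f)
    ultimately show ?thesis
      using f by (metis (mono_tags, lifting) isometry_betw_def mem_Collect_eq)
  qed
  then show "inv\<^bsub>BijGroup M\<^esub> f \<in> {f \<in> Bij M. isometry_betw d f M M}"
    using f restrict_inv_into_Bij[of f M] by (auto simp: inv_BijGroup isometry_betw_def Bij_def)
next
  fix f g
  assume "f \<in> {f \<in> Bij M. isometry_betw d f M M}" "g \<in> {f \<in> Bij M. isometry_betw d f M M}"
  then show "f \<otimes>\<^bsub>BijGroup M\<^esub> g \<in> {f \<in> Bij M. isometry_betw d f M M}"
    using compose_Bij[of f M g]
    by (auto simp: BijGroup_def isometry_betw_def compose_eq Bij_def bij_betwE)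
qed

lemma group_isometry_group: "group (isometry_group M d)"
  unfolding isometry_group_def
  by (rule group.subgroup_imp_group[OF group_BijGroup subgroup_isometries])

definition acts_homogeneously :: "'a set \<Rightarrow> ('a \<Rightarrow> 'a \<Rightarrow> real) \<Rightarrow> ('a \<Rightarrow> 'a) set \<Rightarrow> bool" where
  "acts_homogeneously M d F \<longleftrightarrow>
     (\<forall>A B p. finite A \<and> finite B \<and> A \<subseteq> M \<and> B \<subseteq> M \<and> isometry_betw d p A B
        \<longrightarrow> (\<exists>f\<in>F. \<forall>a\<in>A. f a = p a))"


section \<open>Free groups\<close>

text \<open>The letter \<open>(x, True)\<close> stands for the generator \<open>x\<close> and \<open>(x, False)\<close> for its inverse.\<close>

definition inv_letter :: "'a \<times> bool \<Rightarrow> 'a \<times> bool" where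
  "inv_letter a = (fst a, \<not> snd a)"

definition reduced :: "('a \<times> bool) list \<Rightarrow> bool" where
  "reduced w \<longleftrightarrow> successively (\<lambda>a b. b \<noteq> inv_letter a) w"

fun push :: "'a \<times> bool \<Rightarrow> ('a \<times> bool) list \<Rightarrow> ('a \<times> bool) list" where
  "push a [] = [a]"
| "push a (b # w) = (if b = inv_letter a then w else a # b # w)"

definition reduce :: "('a \<times> bool) list \<Rightarrow> ('a \<times> bool) list" where
  "reduce w = foldr push w []"

definition free_group :: "'a set \<Rightarrow> ('a \<times> bool) list monoid" where
  "free_group X = \<lparr>carrier = {w \<in> lists (X \<times> UNIV). reduced w},
     mult = \<lambda>u v. reduce (u @ v), one = []\<rparr>"

lemma inv_letter_inv_letter [simp]: "inv_letter (inv_letter a) = a"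
  by (simp add: inv_letter_def)

lemma inv_letter_neq [simp]: "inv_letter a \<noteq> a" "a \<noteq> inv_letter a"
  by (auto simp: inv_letter_def prod_eq_iff)

lemma reduced_Nil [simp]: "reduced []"
  by (simp add: reduced_def)

lemma reduced_push: "reduced w \<Longrightarrow> reduced (push a w)"
  by (cases w) (auto simp: reduced_def successively_Cons)

lemma push_eq_Cons: "reduced (a # w) \<Longrightarrow> push a w = a # w"
  by (cases w) (auto simp: reduced_def)

lemma push_push_inv: "reduced w \<Longrightarrow> push a (push (inv_letter a) w) = w"
  by (cases w) (auto simp: push_eq_Cons)

lemma reduced_foldr_push: "reduced v \<Longrightarrow> reduced (foldr push u v)"
  by (induction u) (auto simp: reduced_push)

lemma reduced_reduce: "reduced (reduce w)"
  by (simp add: reduce_def reduced_foldr_push)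

lemma reduce_reduced: "reduced w \<Longrightarrow> reduce w = w"
proof (induction w)
  case (Cons a w)
  then have "reduced w" by (auto simp: reduced_def successively_Cons)
  with Cons show ?case by (simp add: reduce_def push_eq_Cons)
qed (simp add: reduce_def)

lemma foldr_push_push:
  assumes "reduced v"
  shows "foldr push (push a u) v = push a (foldr push u v)"
proof (cases u)
  case (Cons b w)
  then show ?thesis
    using push_push_inv[OF reduced_foldr_push[OF assms], of a w] by auto
qed simp

lemma foldr_push_reduce: "reduced v \<Longrightarrow> foldr push (reduce u) v = foldr push u v"
  by (induction u) (auto simp: reduce_def foldr_push_push)

lemma reduce_append: "reduce (u @ v) = foldr push u (reduce v)"
  by (simp add: reduce_def)

lemma reduce_append_reduce:
  "reduce (reduce u @ v) = reduce (u @ v)" "reduce (u @ reduce v) = reduce (u @ v)"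
  by (simp_all add: reduce_append foldr_push_reduce reduced_reduce reduce_reduced)

lemma set_push: "set (push a w) \<subseteq> insert a (set w)"
  by (cases w) auto

lemma set_reduce: "set (reduce w) \<subseteq> set w"
proof (induction w)
  case (Cons a w)
  have "reduce (a # w) = push a (reduce w)"
    by (simp add: reduce_def)
  with Cons set_push[of a "reduce w"] show ?case by auto
qed (simp add: reduce_def)

lemma reduce_inv: "reduce (map inv_letter (rev w) @ w) = []"
proof (induction w)
  case (Cons a w)
  have "push (inv_letter a) (push a (reduce w)) = reduce w"
    using push_push_inv[OF reduced_reduce, of "inv_letter a" w] by simp
  moreover have "reduce (b # v) = push b (reduce v)" for b :: "'a \<times> bool" and v
    by (simp add: reduce_def)
  ultimately show ?case
    using Cons by (simp add: reduce_append)
qed (simp add: reduce_def)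

lemma reduced_map_rev:
  assumes "reduced w"
  shows "reduced (map inv_letter (rev w))"
proof -
  have "b \<noteq> inv_letter a \<longleftrightarrow> a \<noteq> inv_letter b" for a b :: "'a \<times> bool"
    by (auto simp: inv_letter_def)
  with assms show ?thesis
    by (simp add: reduced_def successively_map del: rev_map)
       (metis (mono_tags, lifting) inv_letter_inv_letter successively_mono)
qed

lemma group_free_group: "group (free_group X)"
proof (rule groupI)
  fix u v w
  assume "u \<in> carrier (free_group X)" "v \<in> carrier (free_group X)"
  then show "u \<otimes>\<^bsub>free_group X\<^esub> v \<in> carrier (free_group X)"
    using set_reduce[of "u @ v"] by (fastforce simp: free_group_def reduced_reduce)
next
  fix u v w
  show "u \<otimes>\<^bsub>free_group X\<^esub> v \<otimes>\<^bsub>free_group X\<^esub> w = u \<otimes>\<^bsub>free_group X\<^esub> (v \<otimes>\<^bsub>free_group X\<^esub> w)"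
    by (simp add: free_group_def reduce_append_reduce)
next
  fix u
  assume u: "u \<in> carrier (free_group X)"
  then have "map inv_letter (rev u) \<in> carrier (free_group X)"
    by (fastforce simp: free_group_def reduced_map_rev inv_letter_def)
  moreover have "map inv_letter (rev u) \<otimes>\<^bsub>free_group X\<^esub> u = \<one>\<^bsub>free_group X\<^esub>"
    by (simp add: free_group_def reduce_inv)
  ultimately show "\<exists>v\<in>carrier (free_group X). v \<otimes>\<^bsub>free_group X\<^esub> u = \<one>\<^bsub>free_group X\<^esub>"
    by blast
qed (auto simp: free_group_def reduce_reduced)

end

theory Submission
  imports Defs
begin

text \<open>
  Call a family of partial isometries indexed by letters, inverse letters getting inverse maps, a
  partial action.  By the extension property, with a Katetov extension keeping the new point off a
  given finite set, a finite partial action can be enlarged so that a letter becomes defined at a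
  given point, with a fresh image.  Tracing a reduced word from a fresh point in this way never
  closes up, so a finite partial action can be enlarged to one in which a given nontrivial reduced
  word moves some point; and a finite partial isometry can be assigned to an unused generator.
  These are countably many dense requirements, and the union of a chain of finite partial actions
  meeting all of them is a faithful homogeneous action of the free group.
\<close>

section \<open>Chains meeting countably many dense families\<close>

text \<open>The Rasiowa-Sikorski construction: enumerate \<open>D\<close> and let stage
  \<open>Suc n\<close> meet the n-th requirement. A requirement is secured only at some stage; its
  passage to the union is checked for each family separately.\<close>

lemma chain_meeting_dense_families:
  assumes "countable D" and "C s"
    and dense: "\<And>R t. R \<in> D \<Longrightarrow> C t \<Longrightarrow> \<exists>u. C u \<and> t \<subseteq> u \<and> R u"
  obtains f :: "nat \<Rightarrow> 'a set" where "mono f" "\<And>n. C (f n)" "\<And>R. R \<in> D \<Longrightarrow> \<exists>n. R (f n)"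
proof (cases "D = {}")
  case True
  show ?thesis by (rule that[of "\<lambda>_. s"]) (use True assms in \<open>auto intro: monoI\<close>)
next
  case False
  have "\<exists>f. \<forall>n. C (f n) \<and> (f n \<subseteq> f (Suc n) \<and> from_nat_into D n (f (Suc n)))"
    by (rule dependent_nat_choice) (use assms from_nat_into[OF False] in blast)+
  then obtain f where f: "\<And>n. C (f n)" "\<And>n. f n \<subseteq> f (Suc n)"
    "\<And>n. from_nat_into D n (f (Suc n))" by blast
  have "\<exists>n. R (f n)" if "R \<in> D" for R
    using from_nat_into_surj[OF assms(1) that] f(3) by metis
  moreover have "mono f" using f(2) by (intro mono_iff_le_Suc[THEN iffD2]) simp
  ultimately show ?thesis using f(1) that by blast
qed


section \<open>Homomorphisms from free groups\<close>

definition word_prod :: "('b, 'm) monoid_scheme \<Rightarrow> ('a \<times> bool \<Rightarrow> 'b) \<Rightarrow> ('a \<times> bool) list \<Rightarrow> 'b" where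
  "word_prod G \<sigma> w = foldr (\<lambda>a x. \<sigma> a \<otimes>\<^bsub>G\<^esub> x) w \<one>\<^bsub>G\<^esub>"

lemma word_prod_simps [simp]:
  "word_prod G \<sigma> [] = \<one>\<^bsub>G\<^esub>" "word_prod G \<sigma> (a # w) = \<sigma> a \<otimes>\<^bsub>G\<^esub> word_prod G \<sigma> w"
  by (simp_all add: word_prod_def)

text \<open>The hypothesis on inverse letters makes the cancellation in \<open>push\<close>
  invisible to the product, so \<open>reduce\<close> does not change the value of a word.\<close>

lemma (in group) word_prod_hom:
  assumes \<sigma>: "\<And>a. \<sigma> a \<in> carrier G" and inv: "\<And>a. \<sigma> a \<otimes> \<sigma> (inv_letter a) = \<one>"
  shows "word_prod G \<sigma> \<in> hom (free_group X) G"
proof -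
  have closed: "word_prod G \<sigma> w \<in> carrier G" for w
    by (induction w) (auto simp: \<sigma>)
  have push: "word_prod G \<sigma> (push a w) = \<sigma> a \<otimes> word_prod G \<sigma> w" for a w
    by (cases "(a, w)" rule: push.cases) (auto simp: \<sigma> closed inv m_assoc[symmetric])
  have reduce: "word_prod G \<sigma> (reduce w) = word_prod G \<sigma> w" for w
    by (induction w) (auto simp: reduce_def push)
  have "word_prod G \<sigma> (u @ v) = word_prod G \<sigma> u \<otimes> word_prod G \<sigma> v" for u v
    by (induction u) (auto simp: \<sigma> closed m_assoc)
  then show ?thesis
    by (auto simp: hom_def free_group_def closed reduce)
qed

text \<open>Words are read from the last letter, matching composition of maps. This is a relation
  because a partial action may leave a letter undefined at the current point.\<close>

fun walk :: "('l \<times> 'a \<times> 'a) set \<Rightarrow> 'l list \<Rightarrow> 'a \<Rightarrow> 'a \<Rightarrow> bool" where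
  "walk S [] x y \<longleftrightarrow> y = x"
| "walk S (a # w) x y \<longleftrightarrow> (\<exists>z. walk S w x z \<and> (a, z, y) \<in> S)"

lemma walk_mono: "walk S w x y \<Longrightarrow> S \<subseteq> T \<Longrightarrow> walk T w x y"
  by (induction w arbitrary: y) auto


section \<open>Finite partial actions on the rational Urysohn space\<close>

context rational_urysohn_space
begin

section \<open>Katetov extensions realised by fresh points\<close>

text \<open>Since \<open>g > 0\<close>, the Katetov extension \<open>x \<mapsto> min (g a + d a x)\<close> over \<open>a \<in> A\<close> is positive
  everywhere, so a point realising it on \<open>F\<close> too cannot lie in \<open>F\<close>.\<close>

lemma fresh_point_extension_nonempty:
  assumes A: "finite A" "A \<subseteq> M" "A \<noteq> {}" and F: "finite F"
    and g: "\<And>a. a \<in> A \<Longrightarrow> g a \<in> \<rat> \<and> 0 < g a"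
    and kat: "\<And>a b. \<lbrakk>a \<in> A; b \<in> A\<rbrakk> \<Longrightarrow> \<bar>g a - g b\<bar> \<le> d a b \<and> d a b \<le> g a + g b"
  shows "\<exists>z\<in>M - F. \<forall>a\<in>A. d z a = g a"
proof -
  define k where "k x = Min ((\<lambda>a. g a + d a x) ` A)" for x
  have k_le: "k x \<le> g a + d a x" if "a \<in> A" for a x
    unfolding k_def using A that by (intro Min_le) auto
  have k_attained: "\<exists>a\<in>A. k x = g a + d a x" for x
  proof -
    have "k x \<in> (\<lambda>a. g a + d a x) ` A" unfolding k_def using A by (intro Min_in) auto
    then show ?thesis by auto
  qed
  have k_pos: "0 < k x" for x
    using k_attained[of x] g nonneg[of _ x] by (metis add_pos_nonneg)
  have k_rat: "k x \<in> \<rat>" if "x \<in> M" for x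
    using k_attained[of x] g rational_dist that A(2) by (metis Rats_add subsetD)
  have k_A: "k a = g a" if a: "a \<in> A" for a
  proof -
    have "k a \<le> g a" using k_le[OF a, of a] a A(2) by auto
    moreover obtain b where "b \<in> A" "k a = g b + d b a" using k_attained by blast
    ultimately show ?thesis using kat[of b a] a by linarith
  qed
  have k_lip: "k x \<le> k y + d x y" if xy: "x \<in> M" "y \<in> M" for x y
  proof -
    obtain a where a: "a \<in> A" "k y = g a + d a y" using k_attained by blast
    have "d a x \<le> d a y + d x y" using triangle'[of a y x] xy a A(2) by auto
    then show ?thesis using a k_le[of a x] by linarith
  qed
  have k_sum: "d x y \<le> k x + k y" if xy: "x \<in> M" "y \<in> M" for x y
  proof -
    obtain a b where a: "a \<in> A" "k x = g a + d a x" and b: "b \<in> A" "k y = g b + d b y"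
      using k_attained by metis
    have "d x y \<le> d a x + d a y" "d a y \<le> d a b + d b y"
      using triangle''[of x a y] triangle[of a b y] xy a b A(2) by auto
    then show ?thesis using kat[of a b] a b by linarith
  qed
  have "\<exists>z\<in>M. \<forall>a\<in>A \<union> (F \<inter> M). d z a = k a"
  proof (rule one_point_extension)
    fix a assume "a \<in> A \<union> (F \<inter> M)"
    then show "k a \<in> \<rat> \<and> 0 \<le> k a" using k_pos[of a] k_rat[of a] A(2) by auto
  next
    fix a b assume "a \<in> A \<union> (F \<inter> M)" "b \<in> A \<union> (F \<inter> M)"
    then have "a \<in> M" "b \<in> M" using A(2) by auto
    then show "\<bar>k a - k b\<bar> \<le> d a b \<and> d a b \<le> k a + k b"
      using k_lip[of a b] k_lip[of b a] k_sum[of a b] commute[of a b] by auto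
  qed (use A F in auto)
  then obtain z where z: "z \<in> M" "\<And>a. a \<in> A \<union> (F \<inter> M) \<Longrightarrow> d z a = k a" by blast
  have "z \<notin> F"
    using z(2)[of z] k_pos[of z] mdist_zero[OF z(1)] z(1) by auto
  then show ?thesis using z k_A by (intro bexI[of _ z]) auto
qed

lemma fresh_point_extension:
  assumes A: "finite A" "A \<subseteq> M" and F: "finite F"
    and g: "\<And>a. a \<in> A \<Longrightarrow> g a \<in> \<rat> \<and> 0 < g a"
    and kat: "\<And>a b. \<lbrakk>a \<in> A; b \<in> A\<rbrakk> \<Longrightarrow> \<bar>g a - g b\<bar> \<le> d a b \<and> d a b \<le> g a + g b"
  shows "\<exists>z\<in>M - F. \<forall>a\<in>A. d z a = g a"
proof (cases "A = {}")
  case True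
  \<comment> \<open>With \<open>A\<close> empty there is no minimum to take, so a base point
    \<open>m\<close> is supplied and the new point is put at distance 1 from it.\<close>
  obtain m where m: "m \<in> M" using one_point_extension[of "{}"] by auto
  show ?thesis
    using fresh_point_extension_nonempty[of "{m}" F "\<lambda>_. 1"] F m True by auto
qed (use fresh_point_extension_nonempty assms in blast)

section \<open>Partial actions and their one-point extensions\<close>

text \<open>\<open>(a, x, y) \<in> S\<close> says that the letter \<open>a\<close> sends \<open>x\<close> to \<open>y\<close>.\<close>

definition partial_action :: "(('i \<times> bool) \<times> 'a \<times> 'a) set \<Rightarrow> bool" where
  "partial_action S \<longleftrightarrow> S \<subseteq> UNIV \<times> M \<times> M \<and>
     (\<forall>a x y. (a, x, y) \<in> S \<longrightarrow> (inv_letter a, y, x) \<in> S) \<and>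
     (\<forall>a x y x' y'. (a, x, y) \<in> S \<longrightarrow> (a, x', y') \<in> S \<longrightarrow> d y y' = d x x')"

lemma partial_actionD:
  assumes "partial_action S" "(a, x, y) \<in> S"
  shows "x \<in> M" "y \<in> M" "(inv_letter a, y, x) \<in> S" "(a, x', y') \<in> S \<Longrightarrow> d y y' = d x x'"
  using assms unfolding partial_action_def by blast+

text \<open>The isometry clause with equal sources gives distance 0; single-valuedness comes from
  there.\<close>

lemma partial_action_unique:
  assumes S: "partial_action S" and xy: "(a, x, y) \<in> S" "(a, x, y') \<in> S"
  shows "y = y'"
  using partial_actionD[OF S xy(1)] partial_actionD[OF S xy(2)] xy zero by (metis mdist_zero)

text \<open>As \<open>inv_letter a\<close> differs from \<open>a\<close>, the two new triples are
  never compared with each other, and the distances for the inverse letter are those for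
  \<open>a\<close> transposed.\<close>

lemma partial_action_insert:
  assumes S: "partial_action S" "x \<in> M" "z \<in> M"
    and new: "\<And>u v. (a, u, v) \<in> S \<Longrightarrow> d z v = d x u"
  shows "partial_action (S \<union> {(a, x, z), (inv_letter a, z, x)})" (is "partial_action ?T")
proof -
  have dist: "d q q' = d p p'" if pq: "(b, p, q) \<in> ?T" "(b, p', q') \<in> ?T" for b p q p' q'
  proof -
    have new_sym: "d v z = d u x" if "(a, u, v) \<in> S" for u v
      using new[OF that] by (simp add: commute)
    have new_inv: "d x v = d z u" "d v x = d u z" if "(inv_letter a, u, v) \<in> S" for u v
      using new new_sym partial_actionD(3)[OF S(1) that] by simp_all
    note old = partial_actionD(4)[OF S(1)]
    consider "b = a" | "b = inv_letter a" | "b \<noteq> a" "b \<noteq> inv_letter a" by blast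
    then show ?thesis
    proof cases
      case 1
      then show ?thesis
        using pq S(2,3) by (auto simp: new new_sym intro: old)
    next
      case 2
      then show ?thesis
        using pq S(2,3) by (auto simp: new_inv intro: old)
    next
      case 3
      then show ?thesis using pq by (auto intro: old)
    qed
  qed
  have "?T \<subseteq> UNIV \<times> M \<times> M" using S unfolding partial_action_def by blast
  moreover have "(inv_letter b, q, p) \<in> ?T" if "(b, p, q) \<in> ?T" for b p q
    using that by (auto intro: partial_actionD(3)[OF S(1)])
  ultimately show ?thesis
    unfolding partial_action_def using dist by blast
qed

text \<open>The image \<open>z\<close> of \<open>x\<close> must have distance \<open>d x u\<close>
  to the image of each \<open>u\<close>. Since \<open>a\<close> acts isometrically, the triangle
  inequality makes this a Katetov function on its range; it is positive because \<open>a\<close> is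
  undefined at \<open>x\<close>.\<close>

lemma partial_action_extend:
  assumes S: "partial_action S" "finite S" and x: "x \<in> M" "\<And>y. (a, x, y) \<notin> S"
    and F: "finite F"
  obtains z where "z \<in> M - F" "partial_action (S \<union> {(a, x, z), (inv_letter a, z, x)})"
proof -
  \<comment> \<open>\<open>A\<close> is the range of the letter \<open>a\<close> in
    \<open>S\<close>, and \<open>h\<close> inverts its map.\<close>
  define A where "A = {v. \<exists>u. (a, u, v) \<in> S}"
  define h where "h v = (SOME u. (a, u, v) \<in> S)" for v
  have h: "(a, h v, v) \<in> S" if "v \<in> A" for v
    using that unfolding A_def h_def by (auto intro: someI)
  have hM: "h v \<in> M" "h v \<noteq> x" if "v \<in> A" for v
    using h[OF that] partial_actionD(1)[OF S(1)] x(2) by blast+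
  have h_eq: "h v = u" if "(a, u, v) \<in> S" for u v
  proof -
    have "(a, h v, v) \<in> S" using h that unfolding A_def by blast
    then show ?thesis
      using that partial_actionD(3)[OF S(1)] partial_action_unique[OF S(1)] by blast
  qed
  have "A \<subseteq> (\<lambda>(b, u, v). v) ` S" unfolding A_def by force
  then have "finite A" using S(2) finite_subset by blast
  moreover have "A \<subseteq> M" using partial_actionD(2)[OF S(1)] unfolding A_def by blast
  moreover have "d x (h v) \<in> \<rat> \<and> 0 < d x (h v)" if "v \<in> A" for v
    using hM[OF that] x(1) rational_dist by auto
  moreover have "\<bar>d x (h v) - d x (h w)\<bar> \<le> d v w \<and> d v w \<le> d x (h v) + d x (h w)"
    if "v \<in> A" "w \<in> A" for v w
  proof -
    have "d v w = d (h v) (h w)" using partial_actionD(4)[OF S(1)] h that by blast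
    then show ?thesis
      using hM that x(1) triangle''[of "h v" x "h w"] triangle[of x "h v" "h w"]
        triangle'[of x "h w" "h v"] by (auto simp: abs_le_iff)
  qed
  ultimately obtain z where z: "z \<in> M - F" "\<And>v. v \<in> A \<Longrightarrow> d z v = d x (h v)"
    using fresh_point_extension[of A F "\<lambda>v. d x (h v)"] F by blast
  have "partial_action (S \<union> {(a, x, z), (inv_letter a, z, x)})"
  proof (rule partial_action_insert[OF S(1) x(1)])
    fix u v assume uv: "(a, u, v) \<in> S"
    then show "d z v = d x u" using z(2)[of v] h_eq[OF uv] unfolding A_def by auto
  qed (use z in auto)
  then show ?thesis using that z(1) by blast
qed

section \<open>Density of the three kinds of requirements\<close>

text \<open>Met for all letters, inverse ones included, this makes the limit maps both total and
  onto.\<close>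

lemma dense_defined:
  assumes S: "partial_action S" "finite S" and x: "x \<in> M"
  shows "\<exists>T. (partial_action T \<and> finite T) \<and> S \<subseteq> T \<and> (\<exists>y. (a, x, y) \<in> T)"
proof (cases "\<exists>y. (a, x, y) \<in> S")
  case False
  then obtain z where "partial_action (S \<union> {(a, x, z), (inv_letter a, z, x)})"
    using partial_action_extend[OF S x, of a "{}"] by blast
  then show ?thesis using S(2) by (intro exI[of _ "S \<union> {(a, x, z), (inv_letter a, z, x)}"]) auto
qed (use S in blast)

text \<open>The last conjunct is the invariant that lets the walk continue to a fresh point: at its end
  \<open>y\<close> only the inverse of the last letter is defined.\<close>

lemma dense_walk:
  assumes S: "partial_action S" "finite S" and w: "reduced w"
  shows "\<exists>T x y. partial_action T \<and> finite T \<and> S \<subseteq> T \<and> x \<in> M \<and> y \<in> M \<and> walk T w x y \<and>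
           (w \<noteq> [] \<longrightarrow> x \<noteq> y) \<and> (\<forall>b v. (b, y, v) \<in> T \<longrightarrow> w \<noteq> [] \<and> b = inv_letter (hd w))"
  using w
proof (induction w)
  case Nil
  have "finite ((\<lambda>(b, u, v). u) ` S)" using S(2) by blast
  then obtain x where x: "x \<in> M - (\<lambda>(b, u, v). u) ` S"
    using fresh_point_extension[of "{}" "(\<lambda>(b, u, v). u) ` S"] by auto
  then have "(b, x, v) \<notin> S" for b v by force
  then show ?case using S x by auto
next
  case (Cons a w)
  then have "reduced w" by (auto simp: reduced_def successively_Cons)
  with Cons.IH obtain T x y where T: "partial_action T" "finite T" "S \<subseteq> T" and
    xy: "x \<in> M" "y \<in> M" "walk T w x y"
    and tip: "\<And>b v. (b, y, v) \<in> T \<Longrightarrow> w \<noteq> [] \<and> b = inv_letter (hd w)"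
    by blast
  \<comment> \<open>Reducedness excludes \<open>a = inv_letter (hd w)\<close>, the only letter that
    may be defined at \<open>y\<close>.\<close>
  have "(a, y, v) \<notin> T" for v
    using tip[of a v] Cons.prems by (cases w) (auto simp: reduced_def)
  \<comment> \<open>Avoiding \<open>x\<close> keeps the walk from closing up; avoiding
    \<open>y\<close> and all sources in \<open>T\<close> leaves the new inverse triple as the only
    one starting at \<open>z\<close>.\<close>
  moreover have "finite (insert x (insert y ((\<lambda>(b, u, v). u) ` T)))" using T by blast
  ultimately obtain z where z: "z \<in> M - insert x (insert y ((\<lambda>(b, u, v). u) ` T))"
    and act: "partial_action (T \<union> {(a, y, z), (inv_letter a, z, y)})"
    using partial_action_extend[OF T(1,2) xy(2)] by metis
  let ?T = "T \<union> {(a, y, z), (inv_letter a, z, y)}"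
  have "walk ?T (a # w) x z" using walk_mono[OF xy(3), of ?T] by auto
  moreover have "(b, z, v) \<notin> T" for b v using z by force
  ultimately show ?case
    using act T xy z by (intro exI[of _ ?T] exI[of _ x] exI[of _ z]) auto
qed

lemma dense_moving:
  assumes "partial_action S" "finite S" "reduced w" "w \<noteq> []"
  shows "\<exists>T. (partial_action T \<and> finite T) \<and> S \<subseteq> T \<and> (\<exists>x\<in>M. \<exists>y\<in>M. walk T w x y \<and> x \<noteq> y)"
  using dense_walk[OF assms(1-3)] assms(4) by blast

text \<open>Graphs stand in for maps because finite subsets of \<open>M \<times> M\<close> form a
  countable family, whereas functions carry irrelevant values off the finite domain.\<close>

definition partial_isometry_graph :: "('a \<times> 'a) set \<Rightarrow> bool" where
  "partial_isometry_graph P \<longleftrightarrow> finite P \<and> P \<subseteq> M \<times> M \<and>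
     (\<forall>(x, y)\<in>P. \<forall>(x', y')\<in>P. d y y' = d x x')"

lemma dense_homogeneous:
  fixes S :: "((nat \<times> bool) \<times> 'a \<times> 'a) set"
  assumes S: "partial_action S" "finite S" and P: "partial_isometry_graph P"
  shows "\<exists>T. (partial_action T \<and> finite T) \<and> S \<subseteq> T \<and> (\<exists>a. \<forall>(x, y)\<in>P. (a, x, y) \<in> T)"
proof -
  have "finite ((\<lambda>(b, u, v). fst b) ` S)" using S(2) by blast
  then obtain n where "n \<notin> (\<lambda>(b, u, v). fst b) ` S" using ex_new_if_finite infinite_UNIV_nat by blast
  then have n: "((n, e), u, v) \<notin> S" for e u v by force
  let ?T = "S \<union> (\<lambda>(x, y). ((n, True), x, y)) ` P \<union> (\<lambda>(x, y). ((n, False), y, x)) ` P"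
  have T_cases: "(a, x, y) \<in> S \<and> fst a \<noteq> n \<or> a = (n, True) \<and> (x, y) \<in> P \<or> a = (n, False) \<and> (y, x) \<in> P"
    if "(a, x, y) \<in> ?T" for a x y
    using that n by (cases a) auto
  have P_dist: "d y y' = d x x'" if "(x, y) \<in> P" "(x', y') \<in> P" for x y x' y'
    using P that unfolding partial_isometry_graph_def by blast
  have "partial_action ?T"
    unfolding partial_action_def
  proof (intro conjI allI impI)
    show "?T \<subseteq> UNIV \<times> M \<times> M"
      using partial_actionD(1,2)[OF S(1)] P unfolding partial_isometry_graph_def by auto
  next
    fix a x y assume "(a, x, y) \<in> ?T"
    then show "(inv_letter a, y, x) \<in> ?T"
      using partial_actionD(3)[OF S(1)] by (force simp: inv_letter_def)
  next
    fix a x y x' y' assume "(a, x, y) \<in> ?T" "(a, x', y') \<in> ?T"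
    from T_cases[OF this(1)] T_cases[OF this(2)] show "d y y' = d x x'"
      by (elim disjE) (auto intro: partial_actionD(4)[OF S(1)] P_dist P_dist[symmetric])
  qed
  moreover have "finite ?T" using S P unfolding partial_isometry_graph_def by blast
  moreover have "\<forall>(x, y)\<in>P. ((n, True), x, y) \<in> ?T" by force
  ultimately show ?thesis by blast
qed

section \<open>The generic action\<close>

lemma countable_partial_isometry_graphs: "countable {P. partial_isometry_graph P}"
proof (rule countable_subset)
  show "{P. partial_isometry_graph P} \<subseteq> {P. finite P \<and> P \<subseteq> M \<times> M}"
    unfolding partial_isometry_graph_def by blast
  show "countable {P. finite P \<and> P \<subseteq> M \<times> M}"
    by (intro countable_Collect_finite_subset countable_SIGMA countable_space)
qed

lemma generic_action:
  obtains G :: "((nat \<times> bool) \<times> 'a \<times> 'a) set" where "partial_action G"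
    "\<And>a x. x \<in> M \<Longrightarrow> \<exists>y. (a, x, y) \<in> G"
    "\<And>w. reduced w \<Longrightarrow> w \<noteq> [] \<Longrightarrow> \<exists>x\<in>M. \<exists>y\<in>M. walk G w x y \<and> x \<noteq> y"
    "\<And>P. partial_isometry_graph P \<Longrightarrow> \<exists>a. \<forall>(x, y)\<in>P. (a, x, y) \<in> G"
proof -
  \<comment> \<open>\<open>D1\<close> yields totality, \<open>D2\<close> a trivial kernel,
    \<open>D3\<close> homogeneity. Each requirement is witnessed by finitely many triples, so it
    survives in the union of the chain.\<close>
  define D1 :: "(((nat \<times> bool) \<times> 'a \<times> 'a) set \<Rightarrow> bool) set"
    where "D1 = (\<lambda>(a, x) T. \<exists>y. (a, x, y) \<in> T) ` (UNIV \<times> M)"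
  define D2 :: "(((nat \<times> bool) \<times> 'a \<times> 'a) set \<Rightarrow> bool) set"
    where "D2 = (\<lambda>w T. \<exists>x\<in>M. \<exists>y\<in>M. walk T w x y \<and> x \<noteq> y) ` {w. reduced w \<and> w \<noteq> []}"
  define D3 :: "(((nat \<times> bool) \<times> 'a \<times> 'a) set \<Rightarrow> bool) set"
    where "D3 = (\<lambda>P T. \<exists>a. \<forall>(x, y)\<in>P. (a, x, y) \<in> T) ` {P. partial_isometry_graph P}"
  have "countable D1"
    unfolding D1_def by (intro countable_image countable_SIGMA countable_space) auto
  moreover have "countable D2"
    unfolding D2_def by (intro countable_image) auto
  moreover have "countable D3"
    unfolding D3_def by (intro countable_image countable_partial_isometry_graphs)
  ultimately have "countable (D1 \<union> D2 \<union> D3)" by blast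
  moreover have "partial_action {} \<and> finite ({} :: ((nat \<times> bool) \<times> 'a \<times> 'a) set)"
    by (simp add: partial_action_def)
  moreover have "\<exists>U. (partial_action U \<and> finite U) \<and> T \<subseteq> U \<and> R U"
    if R: "R \<in> D1 \<union> D2 \<union> D3" and T: "partial_action T \<and> finite T" for R T
  proof -
    consider "R \<in> D1" | "R \<in> D2" | "R \<in> D3" using R by blast
    then show ?thesis
    proof cases
      case 1
      then show ?thesis using dense_defined T unfolding D1_def by fastforce
    next
      case 2
      then show ?thesis using dense_moving T unfolding D2_def by fastforce
    next
      case 3
      then show ?thesis using dense_homogeneous T unfolding D3_def by fastforce
    qed
  qed
  ultimately obtain f :: "nat \<Rightarrow> _" where f: "mono f" "\<And>n. partial_action (f n) \<and> finite (f n)"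
    "\<And>R. R \<in> D1 \<union> D2 \<union> D3 \<Longrightarrow> \<exists>n. R (f n)"
    using chain_meeting_dense_families[of "D1 \<union> D2 \<union> D3" "\<lambda>T. partial_action T \<and> finite T" "{}"]
    by metis
  define G where "G = (\<Union>n. f n)"
  have sub: "f n \<subseteq> G" for n unfolding G_def by blast
  have "partial_action G"
    unfolding partial_action_def
  proof (intro conjI allI impI)
    show "G \<subseteq> UNIV \<times> M \<times> M"
      using f(2) unfolding partial_action_def G_def by blast
    show "(inv_letter a, y, x) \<in> G" if "(a, x, y) \<in> G" for a x y
      using that f(2) partial_actionD(3) unfolding G_def by blast
  next
    fix a x y x' y' assume "(a, x, y) \<in> G" "(a, x', y') \<in> G"
    \<comment> \<open>The isometry clause involves two triples, and these lie in a common stage of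
      the chain.\<close>
    then obtain m n where "(a, x, y) \<in> f m" "(a, x', y') \<in> f n" unfolding G_def by blast
    then have "(a, x, y) \<in> f (max m n)" "(a, x', y') \<in> f (max m n)"
      using monoD[OF f(1), of m "max m n"] monoD[OF f(1), of n "max m n"] by auto
    then show "d y y' = d x x'" using f(2) partial_actionD(4) by blast
  qed
  moreover have "\<exists>y. (a, x, y) \<in> G" if "x \<in> M" for a x
  proof -
    have "(\<lambda>T. \<exists>y. (a, x, y) \<in> T) \<in> D1" using that unfolding D1_def by force
    then show ?thesis using f(3) sub by blast
  qed
  moreover have "\<exists>x\<in>M. \<exists>y\<in>M. walk G w x y \<and> x \<noteq> y" if "reduced w" "w \<noteq> []" for w
  proof -
    have "(\<lambda>T. \<exists>x\<in>M. \<exists>y\<in>M. walk T w x y \<and> x \<noteq> y) \<in> D2" using that unfolding D2_def by blast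
    then obtain n x y where "x \<in> M" "y \<in> M" "walk (f n) w x y" "x \<noteq> y" using f(3) by blast
    then show ?thesis using walk_mono[OF _ sub] by blast
  qed
  moreover have "\<exists>a. \<forall>(x, y)\<in>P. (a, x, y) \<in> G" if "partial_isometry_graph P" for P
  proof -
    have "(\<lambda>T. \<exists>a. \<forall>(x, y)\<in>P. (a, x, y) \<in> T) \<in> D3" using that unfolding D3_def by blast
    then show ?thesis using f(3) sub by blast
  qed
  ultimately show ?thesis using that by blast
qed

end


section \<open>The free homogeneous action\<close>

text \<open>The action is the inclusion into \<open>BijGroup M\<close>, an injective homomorphism on
  any subgroup.\<close>

lemma faithful_action_isometries:
  assumes "subgroup F (isometry_group M d)"
  shows "faithful_action ((isometry_group M d)\<lparr>carrier := F\<rparr>) M (\<lambda>f. f)"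
proof -
  have "group ((isometry_group M d)\<lparr>carrier := F\<rparr>)"
    by (rule group.subgroup_imp_group[OF group_isometry_group assms])
  moreover have "(\<lambda>f. f) \<in> hom ((isometry_group M d)\<lparr>carrier := F\<rparr>) (BijGroup M)"
    using subgroup.subset[OF assms] by (auto simp: hom_def isometry_group_def BijGroup_def)
  ultimately show ?thesis
    by (intro faithful_action.intro group_action.intro group_hom.intro group_hom_axioms.intro
        faithful_action_axioms.intro group_BijGroup) auto
qed

theorem theorem20:
  fixes M :: "'a set" and d :: "'a \<Rightarrow> 'a \<Rightarrow> real"
  assumes "rational_urysohn_space M d"
  shows "\<exists>F. subgroup F (isometry_group M d) \<and>
             faithful_action ((isometry_group M d)\<lparr>carrier := F\<rparr>) M (\<lambda>f. f) \<and>
             acts_homogeneously M d F \<and>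
             (isometry_group M d)\<lparr>carrier := F\<rparr> \<cong> free_group (UNIV :: nat set)"
proof -
  interpret rational_urysohn_space M d by (rule assms)
  let ?I = "isometry_group M d" and ?W = "free_group (UNIV :: nat set)"
  interpret I: group ?I by (rule group_isometry_group)
  obtain G :: "((nat \<times> bool) \<times> 'a \<times> 'a) set" where G: "partial_action G"
    and total: "\<And>a x. x \<in> M \<Longrightarrow> \<exists>y. (a, x, y) \<in> G"
    and moving: "\<And>w. reduced w \<Longrightarrow> w \<noteq> [] \<Longrightarrow> \<exists>x\<in>M. \<exists>y\<in>M. walk G w x y \<and> x \<noteq> y"
    and homogeneous: "\<And>P. partial_isometry_graph P \<Longrightarrow> \<exists>a. \<forall>(x, y)\<in>P. (a, x, y) \<in> G"
    by (rule generic_action) (rule that; assumption)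
  \<comment> \<open>The choice is unique since \<open>G\<close> is single-valued; restricting to
    \<open>M\<close> makes the map extensional, as \<open>BijGroup\<close> demands.\<close>
  define \<sigma> where "\<sigma> a = (\<lambda>x\<in>M. SOME y. (a, x, y) \<in> G)" for a
  have \<sigma>: "(a, x, \<sigma> a x) \<in> G" if "x \<in> M" for a x
    using total[OF that, of a] that unfolding \<sigma>_def by (auto intro: someI)
  have \<sigma>_eq: "\<sigma> a x = y" if "(a, x, y) \<in> G" for a x y
    using \<sigma> partial_action_unique[OF G that] partial_actionD(1)[OF G that] by metis
  have \<sigma>M: "\<sigma> a x \<in> M" if "x \<in> M" for a x
    using \<sigma>[OF that] partial_actionD(2)[OF G] by blast
  have \<sigma>_inv: "\<sigma> (inv_letter a) (\<sigma> a x) = x" if "x \<in> M" for a x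
    using \<sigma>_eq partial_actionD(3)[OF G \<sigma>[OF that]] by blast
  have "bij_betw (\<sigma> a) M M" for a
    by (rule bij_betw_byWitness[where f' = "\<sigma> (inv_letter a)"])
      (auto simp: \<sigma>M \<sigma>_inv \<sigma>_inv[of _ "inv_letter a", simplified])
  moreover have "d (\<sigma> a x) (\<sigma> a y) = d x y" if "x \<in> M" "y \<in> M" for a x y
    using partial_actionD(4)[OF G] \<sigma> that by blast
  ultimately have \<sigma>_closed: "\<sigma> a \<in> carrier ?I" for a
    by (auto simp: isometry_group_def Bij_def isometry_betw_def \<sigma>_def)
  have mult: "(f \<otimes>\<^bsub>?I\<^esub> g) x = f (g x)" if "f \<in> carrier ?I" "g \<in> carrier ?I" "x \<in> M" for f g x
    using that by (simp add: isometry_group_def BijGroup_def compose_def)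
  have one: "\<one>\<^bsub>?I\<^esub> = (\<lambda>x\<in>M. x)"
    by (simp add: isometry_group_def BijGroup_def)
  have \<sigma>_mult_inv: "\<sigma> a \<otimes>\<^bsub>?I\<^esub> \<sigma> (inv_letter a) = \<one>\<^bsub>?I\<^esub>" for a
  proof (rule extensionalityI[of _ M])
    show "\<sigma> a \<otimes>\<^bsub>?I\<^esub> \<sigma> (inv_letter a) \<in> extensional M"
      using I.m_closed[OF \<sigma>_closed \<sigma>_closed, of a "inv_letter a"]
      by (auto simp: isometry_group_def Bij_def)
  qed (auto simp: one mult \<sigma>_closed \<sigma>_inv[of _ "inv_letter a", simplified])
  let ?\<phi> = "word_prod ?I \<sigma>"
  have hom: "?\<phi> \<in> hom ?W ?I"
    by (intro I.word_prod_hom \<sigma>_closed \<sigma>_mult_inv)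
  interpret \<phi>: group_hom ?W ?I ?\<phi>
    by (intro group_hom.intro group_hom_axioms.intro hom group_free_group group_isometry_group)
  have closed: "?\<phi> w \<in> carrier ?I" for w
    by (induction w) (auto simp: \<sigma>_closed)
  have walk: "x \<in> M \<Longrightarrow> walk G w x y \<Longrightarrow> ?\<phi> w x = y" for w x y
    by (induction w arbitrary: y) (auto simp: one mult \<sigma>_closed closed \<sigma>_eq)
  \<comment> \<open>The value of a word at \<open>x\<close> is the end of its walk from
    \<open>x\<close>, and some walk along a nontrivial reduced word ends away from its
    start.\<close>
  have "kernel ?W ?I ?\<phi> = {\<one>\<^bsub>?W\<^esub>}"
  proof -
    have "w = []" if "reduced w" "?\<phi> w = \<one>\<^bsub>?I\<^esub>" for w
      using moving[OF that(1)] walk[of _ w] that(2) by (auto simp: one)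
    then show ?thesis by (auto simp: kernel_def free_group_def)
  qed
  then have inj: "inj_on ?\<phi> (carrier ?W)" by (simp add: \<phi>.inj_iff_trivial_ker)
  define F where "F = ?\<phi> ` carrier ?W"
  have sub: "subgroup F ?I" unfolding F_def by (rule \<phi>.img_is_subgroup)
  have "?\<phi> \<in> iso ?W (?I\<lparr>carrier := F\<rparr>)"
    using hom inj by (auto simp: iso_def hom_def F_def bij_betw_def)
  then have "?I\<lparr>carrier := F\<rparr> \<cong> ?W"
    using group.iso_sym[OF group_free_group] by (auto simp: is_iso_def)
  moreover have "acts_homogeneously M d F"
    unfolding acts_homogeneously_def
  proof (intro allI impI, elim conjE)
    fix A B p
    assume A: "finite A" "A \<subseteq> M" "B \<subseteq> M" and p: "isometry_betw d p A B"
    then have "partial_isometry_graph ((\<lambda>x. (x, p x)) ` A)"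
      by (auto simp: partial_isometry_graph_def isometry_betw_def bij_betw_def)
    \<comment> \<open>A single letter already extends \<open>p\<close>, so a one-letter word is the
      witness in \<open>F\<close>.\<close>
    then obtain a where "\<forall>(x, y)\<in>(\<lambda>x. (x, p x)) ` A. (a, x, y) \<in> G"
      using homogeneous by blast
    then have "\<forall>x\<in>A. \<sigma> a x = p x" using \<sigma>_eq by blast
    moreover have "?\<phi> [a] = \<sigma> a" by (simp add: \<sigma>_closed)
    moreover have "[a] \<in> carrier ?W"
      by (auto simp: free_group_def reduced_def mem_Times_iff)
    ultimately show "\<exists>f\<in>F. \<forall>a\<in>A. f a = p a" unfolding F_def by (metis image_eqI)
  qed
  ultimately show ?thesis using sub faithful_action_isometries[OF sub] by blast
qed

end
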